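(* Let $n$ be a positive integer and let $2k$ be an even divisor of $2n$. The number of elements of $S_n$ fixed by $\mathcal{K}^{2k}$ is $\left(\frac nk\right)^k k!$, and the number of orbits of size $2k$ of the Kreweras complement $\mathcal{K}$ on $S_n$ equals $$\frac{\left(\frac nk\right)^k k!-T}{2k},$$ where $T$ is the total number of elements of $S_n$ lying in orbits of $\mathcal{K}$ whose size is a proper divisor of $2k$.
   Context: Permutations are in one-line notation and composed right to left. Let $c=234\cdots n1\in S_n$ (i.e. $c(i)=i+1$ for $i<n$, $c(n)=1$). The Kreweras complement is $\mathcal{K}:S_n\to S_n$, $\mathcal{K}(\sigma)=c\circ\sigma^{-1}$. *)

theory Defs
  imports Complex_Main "HOL-Combinatorics.Permutations" "HOL-Combinatorics.Orbits"
begin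

definition Sym :: "nat \<Rightarrow> (nat \<Rightarrow> nat) set" where
  "Sym n = {\<sigma>. \<sigma> permutes {1..n}}"

text \<open>The identity branch outside \<open>{1..n}\<close> makes \<open>long_cycle n\<close> an element of \<open>Sym n\<close>.\<close>

definition long_cycle :: "nat \<Rightarrow> nat \<Rightarrow> nat" where
  "long_cycle n i = (if i \<in> {1..<n} then i + 1 else if i = n then 1 else i)"

definition kreweras :: "nat \<Rightarrow> (nat \<Rightarrow> nat) \<Rightarrow> (nat \<Rightarrow> nat)" where
  "kreweras n \<sigma> = long_cycle n \<circ> inv \<sigma>"

text \<open>The library's \<open>orbit f x\<close> consists of the iterates \<open>(f ^^ m) x\<close> with \<open>m > 0\<close>. As
  \<open>kreweras n\<close> permutes the finite set \<open>Sym n\<close>, this is the full orbit and contains \<open>x\<close>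
  (see \<open>self_in_kreweras_orbit\<close>).\<close>

definition kreweras_orbits :: "nat \<Rightarrow> (nat \<Rightarrow> nat) set set" where
  "kreweras_orbits n = orbit (kreweras n) ` Sym n"

lemma long_cycle_permutes:
  assumes "n > 0"
  shows "long_cycle n permutes {1..n}"
proof (rule bij_imp_permutes)
  have inj: "inj_on (long_cycle n) {1..n}"
    by (auto simp: inj_on_def long_cycle_def split: if_splits)
  have "long_cycle n ` {1..n} \<subseteq> {1..n}"
    using assms by (auto simp: long_cycle_def)
  then show "bij_betw (long_cycle n) {1..n} {1..n}"
    using inj by (simp add: bij_betw_def endo_inj_surj)
qed (use assms in \<open>auto simp: long_cycle_def\<close>)

lemma kreweras_in_Sym:
  assumes "n > 0" "\<sigma> \<in> Sym n"
  shows "kreweras n \<sigma> \<in> Sym n"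
  using assms long_cycle_permutes
  by (auto simp: Sym_def kreweras_def intro: permutes_compose permutes_inv)

lemma inj_on_kreweras:
  assumes "n > 0"
  shows "inj_on (kreweras n) (Sym n)"
proof (rule inj_onI)
  fix \<sigma> \<tau> assume st: "\<sigma> \<in> Sym n" "\<tau> \<in> Sym n" "kreweras n \<sigma> = kreweras n \<tau>"
  have "inj (long_cycle n)"
    using permutes_inj[OF long_cycle_permutes[OF assms]] .
  then have "inv \<sigma> = inv \<tau>"
    using st(3) by (auto simp: kreweras_def fun_eq_iff inj_def)
  then show "\<sigma> = \<tau>"
    using st(1,2) by (metis Sym_def mem_Collect_eq permutes_inv_inv)
qed

lemma self_in_kreweras_orbit:
  assumes n: "n > 0" and s: "\<sigma> \<in> Sym n"
  shows "\<sigma> \<in> orbit (kreweras n) \<sigma>"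
proof -
  let ?f = "kreweras n"
  have fin: "finite (Sym n)" by (simp add: Sym_def finite_permutations)
  have it: "(?f ^^ m) \<sigma> \<in> Sym n" for m
    by (induction m) (use n s kreweras_in_Sym in auto)
  have "\<not> inj (\<lambda>m. (?f ^^ m) \<sigma>)"
  proof
    assume "inj (\<lambda>m. (?f ^^ m) \<sigma>)"
    then have "infinite (range (\<lambda>m. (?f ^^ m) \<sigma>))" by (simp add: finite_image_iff)
    moreover have "range (\<lambda>m. (?f ^^ m) \<sigma>) \<subseteq> Sym n" using it by blast
    ultimately show False using fin finite_subset by blast
  qed
  then obtain a b where ab: "a < b" "(?f ^^ a) \<sigma> = (?f ^^ b) \<sigma>"
    unfolding inj_def by (metis linorder_neqE_nat)
  have "(?f ^^ a) \<sigma> = (?f ^^ (a + d)) \<sigma> \<Longrightarrow> \<sigma> = (?f ^^ d) \<sigma>" for d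
  proof (induction a)
    case (Suc a)
    then have "?f ((?f ^^ a) \<sigma>) = ?f ((?f ^^ (a + d)) \<sigma>)" by simp
    then show ?case
      using Suc.IH it inj_onD[OF inj_on_kreweras[OF n]] by blast
  qed simp
  from this[of "b - a"] ab have "\<sigma> = (?f ^^ (b - a)) \<sigma>" "b - a > 0" by auto
  then show ?thesis unfolding orbit_altdef by blast
qed

end

theory Submission
  imports Defs
begin

text \<open>Since \<open>\<K>\<^sup>2(\<sigma>) = c \<circ> \<sigma> \<circ> c\<^sup>-\<^sup>1\<close>, the fixed points of \<open>\<K>\<^bsup>2k\<^esup>\<close> form the centralizer of \<open>c\<^sup>k\<close>, whose cycles
  are the \<open>k\<close> residue classes modulo \<open>k\<close>, each of length \<open>m = n/k\<close>. An element of the centralizer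
  permutes these classes (\<open>k!\<close> ways) and is determined on each of them by a rotation
  (\<open>m\<close> ways). For the second claim, \<open>\<K>\<^bsup>2k\<^esup>\<close> fixes \<open>\<sigma>\<close> iff the size of the orbit of \<open>\<sigma>\<close> divides \<open>2k\<close>.\<close>

section \<open>Orbit sizes\<close>

text \<open>The least positive return time \<open>p\<close> is the orbit size, so \<open>n\<close>
  may be reduced modulo \<open>p\<close>, and no positive exponent below \<open>p\<close> returns to
  \<open>x\<close>.\<close>

lemma funpow_eq_self_iff_card_orbit_dvd:
  assumes "x \<in> orbit f x"
  shows "(f ^^ n) x = x \<longleftrightarrow> card (orbit f x) dvd n"
proof -
  define p where "p = funpow_dist1 f x x"
  have fp: "(f ^^ p) x = x" unfolding p_def using assms by (rule funpow_dist1_prop)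
  have "card (orbit f x) = p"
    using orbit_conv_funpow_dist1[OF assms] card_image[OF inj_on_funpow_dist1[OF assms]]
    by (simp add: p_def)
  moreover have "(f ^^ n) x = (f ^^ (n mod p)) x"
    using fp by (simp add: funpow_mod_eq)
  moreover have "(f ^^ (n mod p)) x = x \<longleftrightarrow> n mod p = 0"
  proof
    assume "(f ^^ (n mod p)) x = x"
    moreover have "n mod p < p" by (simp add: p_def)
    ultimately show "n mod p = 0"
      using funpow_dist1_least[of "n mod p" f x x] unfolding p_def by blast
  qed simp
  ultimately show ?thesis by (simp add: dvd_eq_mod_eq_0)
qed

lemma orbit_eq_of_mem:
  assumes "x \<in> orbit f x" "y \<in> orbit f x"
  shows "orbit f y = orbit f x"
  using orbit_swap[OF assms] assms(2) by (auto intro: orbit_trans)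

text \<open>Since every point lies in its own orbit, the orbits partition \<open>S\<close>; summing
  the cardinalities of those of size \<open>d\<close> counts their points.\<close>

lemma card_elements_of_orbits_of_size:
  assumes fin: "finite S"
    and self: "\<And>x. x \<in> S \<Longrightarrow> x \<in> orbit f x"
    and closed: "\<And>x. x \<in> S \<Longrightarrow> f x \<in> S"
  shows "card {x \<in> S. card (orbit f x) = d} = d * card {B \<in> orbit f ` S. card B = d}"
proof -
  have sub: "orbit f x \<subseteq> S" if "x \<in> S" for x
  proof
    fix y assume "y \<in> orbit f x" then show "y \<in> S" by induct (use closed that in auto)
  qed
  have eq: "orbit f y = orbit f x" if "x \<in> S" "y \<in> orbit f x" for x y
    using self that by (simp add: orbit_eq_of_mem)
  let ?C = "{B \<in> orbit f ` S. card B = d}"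
  have un: "{x \<in> S. card (orbit f x) = d} = \<Union> ?C"
  proof (intro set_eqI iffI)
    fix x assume "x \<in> {x \<in> S. card (orbit f x) = d}"
    then show "x \<in> \<Union> ?C" using self by blast
  next
    fix x assume "x \<in> \<Union> ?C"
    then obtain y where "y \<in> S" "x \<in> orbit f y" "card (orbit f y) = d" by auto
    then show "x \<in> {x \<in> S. card (orbit f x) = d}" using sub[of y] eq[of y x] by auto
  qed
  have disj: "pairwise disjnt ?C"
  proof (rule pairwiseI)
    fix A B assume "A \<in> ?C" "B \<in> ?C" "A \<noteq> B"
    then obtain x y where "x \<in> S" "A = orbit f x" "y \<in> S" "B = orbit f y" by blast
    then show "disjnt A B" using \<open>A \<noteq> B\<close> eq[of x] eq[of y] unfolding disjnt_def by blast
  qed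
  have "finite B" if "B \<in> ?C" for B
    using that sub fin by (auto intro: finite_subset)
  then have "card (\<Union> ?C) = sum card ?C"
    using disj by (rule card_Union_disjoint[rotated])
  also have "\<dots> = (\<Sum>B\<in>?C. d)"
    by (rule sum.cong) auto
  finally show ?thesis
    unfolding un by simp
qed

section \<open>Permutations commuting with a rotation\<close>

text \<open>This is the centralizer of the \<open>k\<close>-th power of the long cycle, moved to
  \<open>{..<n}\<close> so that the rotation is addition modulo \<open>n\<close>.\<close>

definition rotation_centralizer :: "nat \<Rightarrow> nat \<Rightarrow> (nat \<Rightarrow> nat) set" where
  "rotation_centralizer n k =
     {\<tau>. \<tau> permutes {..<n} \<and> (\<forall>x<n. \<tau> ((x + k) mod n) = (\<tau> x + k) mod n)}"

lemma rotation_centralizer_iterate: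
  assumes "\<tau> \<in> rotation_centralizer n k" "x < n"
  shows "\<tau> ((x + k * j) mod n) = (\<tau> x + k * j) mod n"
proof (induction j)
  case 0
  \<comment> \<open>Even the base case needs this bound: its right-hand side is
    \<open>\<tau> x mod n\<close>.\<close>
  have "\<tau> x < n"
    using assms permutes_in_image[of \<tau> "{..<n}" x] by (auto simp: rotation_centralizer_def)
  then show ?case using assms(2) by simp
next
  case (Suc j)
  have "\<tau> (((x + k * j) mod n + k) mod n) = (\<tau> ((x + k * j) mod n) + k) mod n"
    using assms by (auto simp: rotation_centralizer_def)
  then show ?case using Suc by (simp add: mod_simps algebra_simps)
qed

text \<open>The point \<open>x = i + k j\<close> with \<open>i < k\<close> and \<open>j < m\<close> has class \<open>x mod k\<close> and position \<open>x div k\<close>;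
  classes are permuted by \<open>\<pi>\<close>, and class \<open>i\<close> is rotated by \<open>g i\<close>.\<close>

definition wreath_perm :: "nat \<Rightarrow> nat \<Rightarrow> (nat \<Rightarrow> nat) \<times> (nat \<Rightarrow> nat) \<Rightarrow> nat \<Rightarrow> nat" where
  "wreath_perm k m = (\<lambda>(\<pi>, g) x.
     if x < k * m then \<pi> (x mod k) + k * ((g (x mod k) + x div k) mod m) else x)"

lemma div_mod_eq_imp_eq:
  fixes x y k :: nat
  shows "x div k = y div k \<Longrightarrow> x mod k = y mod k \<Longrightarrow> x = y"
  by (metis mult_div_mod_eq)

context
  fixes k m :: nat
  assumes k: "k > 0" and m: "m > 0"
begin

text \<open>Class and position can be read off because \<open>\<pi> (x mod k)\<close> stays below
  \<open>k\<close>. The later arguments compare points through these two coordinates.\<close>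

lemma wreath_perm_coords:
  assumes "\<pi> permutes {..<k}" "x < k * m"
  shows "wreath_perm k m (\<pi>, g) x mod k = \<pi> (x mod k)"
    and "wreath_perm k m (\<pi>, g) x div k = (g (x mod k) + x div k) mod m"
proof -
  have "\<pi> (x mod k) < k"
    using permutes_in_image[OF assms(1), of "x mod k"] k by simp
  then show "wreath_perm k m (\<pi>, g) x mod k = \<pi> (x mod k)"
    and "wreath_perm k m (\<pi>, g) x div k = (g (x mod k) + x div k) mod m"
    using assms(2) k by (simp_all add: wreath_perm_def)
qed

lemma wreath_perm_less:
  assumes "\<pi> permutes {..<k}" "x < k * m"
  shows "wreath_perm k m (\<pi>, g) x < k * m"
proof -
  have "wreath_perm k m (\<pi>, g) x div k < m"
    using wreath_perm_coords(2)[OF assms] m by simp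
  then show ?thesis using k by (simp add: div_less_iff_less_mult mult.commute)
qed

lemma wreath_perm_permutes:
  assumes pi: "\<pi> permutes {..<k}"
  shows "wreath_perm k m (\<pi>, g) permutes {..<k * m}"
proof (rule bij_imp_permutes)
  have "inj_on (wreath_perm k m (\<pi>, g)) {..<k * m}"
  proof (rule inj_onI)
    fix x y assume xy: "x \<in> {..<k * m}" "y \<in> {..<k * m}"
      and e: "wreath_perm k m (\<pi>, g) x = wreath_perm k m (\<pi>, g) y"
    have "\<pi> (x mod k) = \<pi> (y mod k)"
      using e xy wreath_perm_coords(1)[OF pi, of _ g] by (metis lessThan_iff)
    then have md: "x mod k = y mod k" using permutes_inj[OF pi] by (simp add: inj_eq)
    have "(g (x mod k) + x div k) mod m = (g (x mod k) + y div k) mod m"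
      using e xy md wreath_perm_coords(2)[OF pi, of _ g] by (metis lessThan_iff)
    \<comment> \<open>Written as equality up to multiples of \<open>m\<close>, the congruence lets
      the common summand \<open>g (x mod k)\<close> cancel.\<close>
    then have "x div k mod m = y div k mod m"
      unfolding nat_mod_eq_iff by simp
    moreover have "x div k < m" "y div k < m"
      using xy k by (simp_all add: div_less_iff_less_mult mult.commute)
    ultimately show "x = y" using md by (intro div_mod_eq_imp_eq[of x k y]) auto
  qed
  moreover have "wreath_perm k m (\<pi>, g) ` {..<k * m} \<subseteq> {..<k * m}"
    using wreath_perm_less[OF pi] by auto
  ultimately show "bij_betw (wreath_perm k m (\<pi>, g)) {..<k * m} {..<k * m}"
    by (simp add: bij_betw_def endo_inj_surj)
qed (simp add: wreath_perm_def)

text \<open>Adding \<open>k\<close> keeps the class and advances the position by one modulo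
  \<open>m\<close>, which commutes with any rotation of the positions.\<close>

lemma wreath_perm_commutes:
  assumes pi: "\<pi> permutes {..<k}" and x: "x < k * m"
  shows "wreath_perm k m (\<pi>, g) ((x + k) mod (k * m)) = (wreath_perm k m (\<pi>, g) x + k) mod (k * m)"
proof -
  let ?W = "wreath_perm k m (\<pi>, g)"
  have md: "(y + k) mod (k * m) mod k = y mod k" for y
    by (simp add: mod_mod_cancel)
  have dv: "(y + k) mod (k * m) div k = Suc (y div k) mod m" for y
    using k by (simp add: mod_mult2_eq)
  have x': "(x + k) mod (k * m) < k * m" using k m by simp
  show ?thesis
  proof (rule div_mod_eq_imp_eq)
    show "?W ((x + k) mod (k * m)) mod k = (?W x + k) mod (k * m) mod k"
      by (simp add: wreath_perm_coords[OF pi] x x' md)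
    show "?W ((x + k) mod (k * m)) div k = (?W x + k) mod (k * m) div k"
      by (simp add: wreath_perm_coords[OF pi] x x' md dv mod_simps)
  qed
qed

text \<open>At a point \<open>i < k\<close>, whose position is 0, the image has class
  \<open>\<pi> i\<close> and position \<open>g i\<close>, so both components can be
  recovered.\<close>

lemma inj_on_wreath_perm:
  "inj_on (wreath_perm k m) ({\<pi>. \<pi> permutes {..<k}} \<times> ({..<k} \<rightarrow>\<^sub>E {..<m}))"
proof (rule inj_onI, clarify)
  fix \<pi> g \<pi>' g'
  assume pi: "\<pi> permutes {..<k}" "\<pi>' permutes {..<k}"
    and g: "g \<in> {..<k} \<rightarrow>\<^sub>E {..<m}" "g' \<in> {..<k} \<rightarrow>\<^sub>E {..<m}"
    and e: "wreath_perm k m (\<pi>, g) = wreath_perm k m (\<pi>', g')"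
  have less: "i < k * m" if "i < k" for i
    using that m by (cases m) auto
  have "\<pi> i = \<pi>' i" for i
  proof (cases "i < k")
    case True
    then show ?thesis
      using wreath_perm_coords(1)[OF pi(1) less, of i g] wreath_perm_coords(1)[OF pi(2) less, of i g'] e
      by simp
  next
    case False
    then show ?thesis using pi by (simp add: permutes_def)
  qed
  moreover have "g i = g' i" for i
  proof (cases "i < k")
    case True
    then have "g i < m" "g' i < m" using g by auto
    then show ?thesis
      using wreath_perm_coords(2)[OF pi(1) less, of i g] wreath_perm_coords(2)[OF pi(2) less, of i g']
        e True
      by simp
  next
    case False
    then show ?thesis using g by (simp add: PiE_def extensional_def)
  qed
  ultimately show "\<pi> = \<pi>' \<and> g = g'" by auto
qed

lemma rotation_centralizer_subset_range_wreath_perm: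
  assumes t: "\<tau> \<in> rotation_centralizer (k * m) k"
  shows "\<tau> \<in> wreath_perm k m ` ({\<pi>. \<pi> permutes {..<k}} \<times> ({..<k} \<rightarrow>\<^sub>E {..<m}))"
proof -
  \<comment> \<open>Both components are read from \<open>\<tau>\<close> at the position-0
    representatives \<open>i < k\<close>; the values elsewhere are those forced by
    \<open>permutes\<close> and by the extensional function space.\<close>
  define \<pi> where "\<pi> = (\<lambda>i. if i < k then \<tau> i mod k else i)"
  define g where "g = (\<lambda>i\<in>{..<k}. \<tau> i div k)"
  have perm: "\<tau> permutes {..<k * m}" using t by (simp add: rotation_centralizer_def)
  have tl: "\<tau> x < k * m" if "x < k * m" for x
    using permutes_in_image[OF perm, of x] that by simp
  have less: "i < k * m" if "i < k" for i
    using that m by (cases m) auto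
  have it: "\<tau> ((i + k * j) mod (k * m)) = (\<tau> i + k * j) mod (k * m)" if "i < k" for i j
    using rotation_centralizer_iterate[OF t less[OF that]] .
  have "inj_on \<pi> {..<k}"
  proof (rule inj_onI)
    fix i i' assume i: "i \<in> {..<k}" "i' \<in> {..<k}" and "\<pi> i = \<pi> i'"
    then have md: "\<tau> i mod k = \<tau> i' mod k" by (simp add: \<pi>_def)
    \<comment> \<open>\<open>j\<close> rotation steps lead from \<open>\<tau> i\<close> to
      \<open>\<tau> i'\<close> within their common class; adding \<open>m\<close> avoids truncated
      subtraction. Commutation then takes \<open>i\<close> to \<open>i'\<close> by the same steps,
      so they share a class and coincide.\<close>
    define j where "j = \<tau> i' div k + (m - \<tau> i div k)"
    have "\<tau> i div k < m" using tl[OF less] i k by (simp add: div_less_iff_less_mult mult.commute)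
    then have "k * (\<tau> i div k) + k * j = k * (\<tau> i' div k) + k * m"
      unfolding j_def by (simp flip: distrib_left)
    then have "\<tau> i + k * j = \<tau> i' + k * m"
      using md mult_div_mod_eq[of k "\<tau> i"] mult_div_mod_eq[of k "\<tau> i'"] by linarith
    then have "\<tau> ((i + k * j) mod (k * m)) = \<tau> i'"
      using it[of i j] i tl[OF less, of i'] by simp
    then have "(i + k * j) mod (k * m) = i'"
      using permutes_inj[OF perm] by (simp add: inj_eq)
    then have "(i + k * j) mod (k * m) mod k = i' mod k" by simp
    then show "i = i'" using i by (simp add: mod_mod_cancel)
  qed
  moreover have "\<pi> ` {..<k} \<subseteq> {..<k}" using k by (auto simp: \<pi>_def)
  ultimately have "bij_betw \<pi> {..<k} {..<k}"
    by (simp add: bij_betw_def endo_inj_surj)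
  then have pi: "\<pi> permutes {..<k}"
    by (rule bij_imp_permutes) (simp add: \<pi>_def)
  have g: "g \<in> {..<k} \<rightarrow>\<^sub>E {..<m}"
    using tl less k by (auto simp: g_def div_less_iff_less_mult mult.commute)
  have "\<tau> x = wreath_perm k m (\<pi>, g) x" for x
  proof (cases "x < k * m")
    case True
    have xk: "x mod k < k" using k by simp
    \<comment> \<open>\<open>x\<close> is reached from its representative \<open>x mod k\<close> by
      \<open>x div k\<close> rotation steps, so \<open>\<tau>\<close> is determined by its values
      below \<open>k\<close>.\<close>
    have tx: "\<tau> x = (\<tau> (x mod k) + k * (x div k)) mod (k * m)"
      using it[OF xk, of "x div k"] True by simp
    show ?thesis
    proof (rule div_mod_eq_imp_eq)
      show "\<tau> x mod k = wreath_perm k m (\<pi>, g) x mod k"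
        unfolding wreath_perm_coords(1)[OF pi True] tx using xk by (simp add: mod_mod_cancel \<pi>_def)
      show "\<tau> x div k = wreath_perm k m (\<pi>, g) x div k"
        unfolding wreath_perm_coords(2)[OF pi True] tx using xk by (simp add: mod_mult2_eq g_def add.commute)
    qed
  next
    case False
    then show ?thesis using perm by (simp add: permutes_def wreath_perm_def)
  qed
  then have "\<tau> = wreath_perm k m (\<pi>, g)" by auto
  then show ?thesis using pi g by auto
qed

lemma card_rotation_centralizer: "card (rotation_centralizer (k * m) k) = m ^ k * fact k"
proof -
  let ?D = "{\<pi>. \<pi> permutes {..<k}} \<times> ({..<k} \<rightarrow>\<^sub>E {..<m})"
  have "rotation_centralizer (k * m) k = wreath_perm k m ` ?D"
    using rotation_centralizer_subset_range_wreath_perm wreath_perm_permutes wreath_perm_commutes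
    by (auto simp: rotation_centralizer_def)
  then have "card (rotation_centralizer (k * m) k) = card ?D"
    using card_image[OF inj_on_wreath_perm] by simp
  then show ?thesis
    by (simp add: card_cartesian_product card_permutations card_PiE)
qed

end

section \<open>Fixed points of even powers of the Kreweras complement\<close>

lemma funpow_long_cycle_Suc:
  assumes "x < n"
  shows "(long_cycle n ^^ j) (Suc x) = Suc ((x + j) mod n)"
proof (induction j)
  case (Suc j)
  have "(x + j) mod n < n" using assms by simp
  then show ?case using Suc by (auto simp: long_cycle_def mod_Suc)
qed (use assms in simp)

lemma funpow_kreweras_in_Sym:
  assumes "n > 0" "\<sigma> \<in> Sym n"
  shows "(kreweras n ^^ j) \<sigma> \<in> Sym n"
  by (induction j) (use assms kreweras_in_Sym in auto)

text \<open>Inverting \<open>long_cycle n \<circ> inv \<sigma>\<close> gives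
  \<open>\<sigma> \<circ> inv (long_cycle n)\<close>, so the square is conjugation by the long
  cycle. Composing on the right keeps inverses out of the induction that follows.\<close>

lemma kreweras_kreweras_comp_long_cycle:
  assumes n: "n > 0" and s: "\<sigma> \<in> Sym n"
  shows "kreweras n (kreweras n \<sigma>) \<circ> long_cycle n = long_cycle n \<circ> \<sigma>"
proof -
  have c: "bij (long_cycle n)" using long_cycle_permutes[OF n] by (rule permutes_bij)
  have b: "bij \<sigma>" using s by (auto simp: Sym_def permutes_bij)
  have "inv (long_cycle n \<circ> inv \<sigma>) = \<sigma> \<circ> inv (long_cycle n)"
    using b c by (simp add: o_inv_distrib bij_imp_bij_inv inv_inv_eq)
  then show ?thesis
    using c by (simp add: kreweras_def comp_assoc bij_is_inj)
qed

lemma kreweras_even_power_comp: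
  assumes n: "n > 0" and s: "\<sigma> \<in> Sym n"
  shows "(kreweras n ^^ (2 * j)) \<sigma> \<circ> long_cycle n ^^ j = long_cycle n ^^ j \<circ> \<sigma>"
proof (induction j)
  case (Suc j)
  let ?\<rho> = "(kreweras n ^^ (2 * j)) \<sigma>"
  have "(kreweras n ^^ (2 * Suc j)) \<sigma> \<circ> long_cycle n ^^ Suc j
      = kreweras n (kreweras n ?\<rho>) \<circ> long_cycle n \<circ> long_cycle n ^^ j"
    by (simp add: comp_assoc)
  also have "\<dots> = long_cycle n \<circ> (?\<rho> \<circ> long_cycle n ^^ j)"
    using kreweras_kreweras_comp_long_cycle[OF n funpow_kreweras_in_Sym[OF n s]]
    by (simp add: comp_assoc)
  finally show ?case by (simp only: Suc funpow.simps comp_assoc)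
qed simp

text \<open>The even power is conjugation by a power of the long cycle; for the converse that power
  is cancelled on the right, being surjective.\<close>

lemma kreweras_even_power_fixed_iff:
  assumes n: "n > 0" and s: "\<sigma> \<in> Sym n"
  shows "(kreweras n ^^ (2 * k)) \<sigma> = \<sigma> \<longleftrightarrow> \<sigma> \<circ> long_cycle n ^^ k = long_cycle n ^^ k \<circ> \<sigma>"
proof
  assume "\<sigma> \<circ> long_cycle n ^^ k = long_cycle n ^^ k \<circ> \<sigma>"
  then have e: "(kreweras n ^^ (2 * k)) \<sigma> \<circ> long_cycle n ^^ k = \<sigma> \<circ> long_cycle n ^^ k"
    using kreweras_even_power_comp[OF n s] by simp
  have "bij (long_cycle n ^^ k)"
    using permutes_bij[OF long_cycle_permutes[OF n]] by (rule bij_fn)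
  then show "(kreweras n ^^ (2 * k)) \<sigma> = \<sigma>"
    using e by (metis bij_is_surj comp_assoc surj_iff comp_id)
qed (use kreweras_even_power_comp[OF n s, of k] in simp)

lemma card_kreweras_fixed_eq_card_rotation_centralizer:
  assumes n: "n > 0"
  shows "card {\<sigma> \<in> Sym n. (kreweras n ^^ (2 * k)) \<sigma> = \<sigma>} = card (rotation_centralizer n k)"
proof -
  \<comment> \<open>Conjugation by \<open>Suc\<close>, extended by the identity, in the shape that
    \<open>bij_betw_permutations\<close> expects.\<close>
  define \<Theta> where "\<Theta> = (\<lambda>\<tau> x. if x \<in> {1..n} then Suc (\<tau> (inv_into {..<n} Suc x)) else x)"
  let ?c = "long_cycle n ^^ k"
  have "bij_betw Suc {..<n} {1..n}"
    by (simp add: bij_betw_def image_Suc_lessThan)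
  then have bij: "bij_betw \<Theta> {\<tau>. \<tau> permutes {..<n}} (Sym n)"
    unfolding \<Theta>_def Sym_def by (rule bij_betw_permutations)
  have \<Theta>_Suc: "\<Theta> \<tau> (Suc x) = Suc (\<tau> x)" if "x < n" for \<tau> x
    using that by (simp add: \<Theta>_def inv_into_f_f)
  have comm: "\<Theta> \<tau> \<circ> ?c = ?c \<circ> \<Theta> \<tau> \<longleftrightarrow> (\<forall>x<n. \<tau> ((x + k) mod n) = (\<tau> x + k) mod n)"
    if "\<tau> permutes {..<n}" for \<tau>
  proof -
    have tl: "\<tau> x < n" if "x < n" for x
      using permutes_in_image[OF \<open>\<tau> permutes {..<n}\<close>, of x] that by simp
    \<comment> \<open>Both maps fix every point outside \<open>{1..n}\<close>, so commutation is
      only a condition on the points \<open>Suc x\<close> with \<open>x < n\<close>.\<close>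
    have out: "(\<Theta> \<tau> \<circ> ?c) y = (?c \<circ> \<Theta> \<tau>) y" if "y \<notin> {1..n}" for y
    proof -
      have "(long_cycle n ^^ j) y = y" for j
        by (induction j) (use that n in \<open>auto simp: long_cycle_def\<close>)
      moreover have "\<Theta> \<tau> y = y" using that by (simp only: \<Theta>_def if_False)
      ultimately show ?thesis by simp
    qed
    have ins: "(\<Theta> \<tau> \<circ> ?c) (Suc x) = (?c \<circ> \<Theta> \<tau>) (Suc x) \<longleftrightarrow> \<tau> ((x + k) mod n) = (\<tau> x + k) mod n"
      if "x < n" for x
      using that n tl by (simp add: \<Theta>_Suc funpow_long_cycle_Suc)
    have "\<Theta> \<tau> \<circ> ?c = ?c \<circ> \<Theta> \<tau> \<longleftrightarrow> (\<forall>y\<in>{1..n}. (\<Theta> \<tau> \<circ> ?c) y = (?c \<circ> \<Theta> \<tau>) y)"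
      using out by (metis ext)
    also have "\<dots> \<longleftrightarrow> (\<forall>x<n. (\<Theta> \<tau> \<circ> ?c) (Suc x) = (?c \<circ> \<Theta> \<tau>) (Suc x))"
      unfolding image_Suc_lessThan[symmetric] by auto
    finally show ?thesis using ins by simp
  qed
  have "{\<sigma> \<in> Sym n. (kreweras n ^^ (2 * k)) \<sigma> = \<sigma>} = {\<sigma> \<in> Sym n. \<sigma> \<circ> ?c = ?c \<circ> \<sigma>}"
    using kreweras_even_power_fixed_iff[OF n] by blast
  also have "\<dots> = \<Theta> ` rotation_centralizer n k"
    unfolding bij_betw_imp_surj_on[OF bij, symmetric] rotation_centralizer_def
    by (auto simp: comm simp del: o_apply)
  finally show ?thesis
    using card_image[OF inj_on_subset[OF bij_betw_imp_inj_on[OF bij]], of "rotation_centralizer n k"]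
    by (auto simp: rotation_centralizer_def)
qed

theorem theorem7p6:
  fixes n k :: nat
  assumes "n > 0"
    and "2 * k dvd 2 * n"
  shows "real (card {\<sigma> \<in> Sym n. (kreweras n ^^ (2 * k)) \<sigma> = \<sigma>}) = (real n / real k) ^ k * fact k \<and>
    real (card {orb \<in> kreweras_orbits n. card orb = 2 * k}) =
      ((real n / real k) ^ k * fact k
        - real (card {\<sigma> \<in> Sym n. \<exists>orb \<in> kreweras_orbits n.
            \<sigma> \<in> orb \<and> card orb dvd 2 * k \<and> card orb \<noteq> 2 * k}))
      / real (2 * k)"
proof -
  let ?K = "kreweras n"
  let ?Fix = "{\<sigma> \<in> Sym n. (?K ^^ (2 * k)) \<sigma> = \<sigma>}"
  let ?T = "{\<sigma> \<in> Sym n. \<exists>orb \<in> kreweras_orbits n.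
            \<sigma> \<in> orb \<and> card orb dvd 2 * k \<and> card orb \<noteq> 2 * k}"
  let ?E = "{\<sigma> \<in> Sym n. card (orbit ?K \<sigma>) = 2 * k}"
  \<comment> \<open>Cancelling the factor 2 gives \<open>k dvd n\<close>, so the real quotient
    \<open>real n / real k\<close> is the integer \<open>m\<close>.\<close>
  obtain m where nm: "n = k * m" using assms(2) by auto
  then have k: "k > 0" and m: "m > 0" using assms(1) by auto
  have fixed: "real (card ?Fix) = (real n / real k) ^ k * fact k"
    using card_kreweras_fixed_eq_card_rotation_centralizer[OF assms(1), of k]
      card_rotation_centralizer[OF k m] k by (simp add: nm)
  note self = self_in_kreweras_orbit[OF assms(1)]
  have fin: "finite (Sym n)" by (simp add: Sym_def finite_permutations)
  \<comment> \<open>Any orbit containing \<open>\<sigma>\<close> is the orbit of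
    \<open>\<sigma>\<close>, which removes the existential quantifier.\<close>
  have T: "?T = {\<sigma> \<in> Sym n. card (orbit ?K \<sigma>) dvd 2 * k \<and> card (orbit ?K \<sigma>) \<noteq> 2 * k}"
  proof (intro Collect_cong conj_cong refl iffI)
    fix \<sigma> assume "\<exists>orb \<in> kreweras_orbits n. \<sigma> \<in> orb \<and> card orb dvd 2 * k \<and> card orb \<noteq> 2 * k"
    then obtain \<rho> where "\<rho> \<in> Sym n" "\<sigma> \<in> orbit ?K \<rho>"
      and "card (orbit ?K \<rho>) dvd 2 * k \<and> card (orbit ?K \<rho>) \<noteq> 2 * k"
      unfolding kreweras_orbits_def by blast
    then show "card (orbit ?K \<sigma>) dvd 2 * k \<and> card (orbit ?K \<sigma>) \<noteq> 2 * k"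
      using orbit_eq_of_mem[OF self, of \<rho> \<sigma>] by simp
  next
    fix \<sigma> assume "\<sigma> \<in> Sym n" "card (orbit ?K \<sigma>) dvd 2 * k \<and> card (orbit ?K \<sigma>) \<noteq> 2 * k"
    then show "\<exists>orb \<in> kreweras_orbits n. \<sigma> \<in> orb \<and> card orb dvd 2 * k \<and> card orb \<noteq> 2 * k"
      using self unfolding kreweras_orbits_def by blast
  qed
  \<comment> \<open>Being fixed means that the orbit size divides \<open>2 * k\<close>: either it
    equals \<open>2 * k\<close> or it is a proper divisor.\<close>
  have "?Fix = ?E \<union> ?T"
    unfolding T using funpow_eq_self_iff_card_orbit_dvd[OF self, of _ "2 * k"] by auto
  moreover have "?E \<inter> ?T = {}" unfolding T by auto
  ultimately have "card ?Fix = card ?E + card ?T"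
    using fin by (simp add: card_Un_disjoint)
  moreover have "card ?E = 2 * k * card {orb \<in> kreweras_orbits n. card orb = 2 * k}"
    unfolding kreweras_orbits_def
    using card_elements_of_orbits_of_size[OF fin self kreweras_in_Sym[OF assms(1)]] .
  ultimately have "real (card ?Fix)
      = real (2 * k) * real (card {orb \<in> kreweras_orbits n. card orb = 2 * k}) + real (card ?T)"
    by (simp only: of_nat_add of_nat_mult)
  then have "real (card {orb \<in> kreweras_orbits n. card orb = 2 * k})
      = ((real n / real k) ^ k * fact k - real (card ?T)) / real (2 * k)"
    unfolding fixed using k by (simp only: eq_divide_eq) simp
  with fixed show ?thesis ..
qed

end
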